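(* Let $K\geq 2$ be an integer and let $a_1,\ldots,a_K$ be positive integers with distinct square-free parts. Let $m_1,\ldots,m_K$ be integers, not all zero, and put $$\Lambda:=\bigg|\sum_{n\leq K}m_n\sqrt{a_n}\bigg|.$$ Then $$\Lambda\geq\bigg(\frac{1}{1-2^{1-K}}\sum_{n\leq K}m_n^2a_n\bigg)^{-(2^{K-1}-1)/2}.$$ In particular, $$\Lambda\geq C_K\bigg(\max_{n\leq K}|m_n|\sqrt{a_n}\cdot\sqrt K\bigg)^{-(2^{K-1}-1)},$$ where $C_K=(1-2^{1-K})^{(2^{K-1}-1)/2}$.
   Context: Every positive integer $a$ can be decomposed as $a=c^2d$ with $c,d$ positive integers and $d$ square-free; $d$ is called the square-free part of $a$. The index $n$ ranges over the integers $1\leq n\leq K$. *)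

theory Defs
  imports Complex_Main "HOL-Computational_Algebra.Squarefree"
begin

end

theory Submission
  imports Defs "HOL-Analysis.Convex"
begin

text \<open>
  Put \<open>x\<^sub>n = m\<^sub>n \<surd>a\<^sub>n\<close> and consider the product \<open>P\<close> of the \<open>2\<^bsup>K-1\<^esup>\<close> sums
  \<open>x\<^sub>1 \<plusminus> x\<^sub>2 \<plusminus> \<dots> \<plusminus> x\<^sub>K\<close>, of which \<open>\<Lambda>\<close> is one up to sign. For \<open>K \<ge> 2\<close> it is an even
  polynomial with integer coefficients in each \<open>x\<^sub>n\<close>, hence a polynomial in the integers
  \<open>x\<^sub>n\<^sup>2\<close>, hence an integer (\<open>prod_signed_sums_Ints\<close>). No factor vanishes, because the
  square roots of integers with distinct square-free parts are linearly independent over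
  \<open>\<rat>\<close> (\<open>sqrt_linear_independent\<close>) and the \<open>m\<^sub>n\<close> are not all zero. Therefore \<open>\<bar>P\<bar> \<ge> 1\<close>.

  The squares of all the factors add up to \<open>2\<^bsup>K-1\<^esup> \<Sum> x\<^sub>n\<^sup>2\<close>, since the mixed terms cancel. With
  \<open>N = 2\<^bsup>K-1\<^esup> - 1\<close>, the inequality between the arithmetic and the geometric mean bounds the
  product of the squares of the \<open>N\<close> factors other than \<open>\<plusminus>\<Lambda>\<close> by \<open>(2\<^bsup>K-1\<^esup> / N * \<Sum> x\<^sub>n\<^sup>2)\<^sup>N\<close>,
  and \<open>2\<^bsup>K-1\<^esup> / N = 1 / (1 - 2\<^bsup>1-K\<^esup>)\<close>. Dividing \<open>1 \<le> P\<^sup>2\<close> by this bounds \<open>\<Lambda>\<^sup>2\<close> from below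
  (\<open>abs_sum_ge\<close>), which is the first inequality; the second one follows from \<open>\<Sum> x\<^sub>n\<^sup>2 \<le> K max x\<^sub>n\<^sup>2\<close>.
\<close>

section \<open>Linear independence of square roots\<close>

definition real_subfield :: "real set \<Rightarrow> bool" where
  "real_subfield F \<longleftrightarrow> \<rat> \<subseteq> F \<and> (\<forall>x\<in>F. \<forall>y\<in>F. x + y \<in> F \<and> x * y \<in> F) \<and> (\<forall>x\<in>F. inverse x \<in> F)"

lemma real_subfieldD:
  assumes "real_subfield F"
  shows "x \<in> \<rat> \<Longrightarrow> x \<in> F"
    and "x \<in> F \<Longrightarrow> y \<in> F \<Longrightarrow> x + y \<in> F"
    and "x \<in> F \<Longrightarrow> y \<in> F \<Longrightarrow> x * y \<in> F"
    and "x \<in> F \<Longrightarrow> y \<in> F \<Longrightarrow> x - y \<in> F"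
    and "x \<in> F \<Longrightarrow> y \<in> F \<Longrightarrow> x / y \<in> F"
proof -
  show 1: "x \<in> \<rat> \<Longrightarrow> x \<in> F" for x
    using assms by (auto simp: real_subfield_def)
  show 2: "x \<in> F \<Longrightarrow> y \<in> F \<Longrightarrow> x + y \<in> F"
    and 3: "x \<in> F \<Longrightarrow> y \<in> F \<Longrightarrow> x * y \<in> F" for x y
    using assms by (auto simp: real_subfield_def)
  have m: "y \<in> F \<Longrightarrow> - y \<in> F" for y
    using 3[of "-1" y] 1[of "-1"] by simp
  show "x \<in> F \<Longrightarrow> y \<in> F \<Longrightarrow> x - y \<in> F"
    using 2[of x "-y"] m[of y] by simp
  show "x \<in> F \<Longrightarrow> y \<in> F \<Longrightarrow> x / y \<in> F"
    using 3[of x "inverse y"] assms by (simp add: real_subfield_def field_simps)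
qed

lemma real_subfield_sum:
  assumes "real_subfield F" "\<And>i. i \<in> I \<Longrightarrow> f i \<in> F"
  shows "sum f I \<in> F"
  using assms(2) real_subfieldD(1)[OF assms(1), of 0]
  by (induction I rule: infinite_finite_induct) (auto intro: real_subfieldD(2)[OF assms(1)])

lemma real_subfield_Rats: "real_subfield \<rat>"
  by (auto simp: real_subfield_def)

lemma real_subfield_adjoin_sqrt:
  assumes F: "real_subfield F" and s: "s * s \<in> F" "s \<notin> F"
  shows "real_subfield {a + b * s | a b. a \<in> F \<and> b \<in> F}" (is "real_subfield ?E")
proof -
  note cl = real_subfieldD[OF F]
  have "\<rat> \<subseteq> ?E"
  proof
    fix x :: real assume "x \<in> \<rat>"
    thus "x \<in> ?E" using cl(1)[of x] cl(1)[of 0] by (intro CollectI exI[of _ x] exI[of _ 0]) auto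
  qed
  moreover have "x + y \<in> ?E \<and> x * y \<in> ?E" if "x \<in> ?E" "y \<in> ?E" for x y
  proof -
    from that obtain a b c d where F4: "a \<in> F" "b \<in> F" "c \<in> F" "d \<in> F"
      and xy: "x = a + b * s" "y = c + d * s" by auto
    have "x + y = (a + c) + (b + d) * s" and "x * y = (a * c + b * d * (s * s)) + (a * d + b * c) * s"
      by (simp_all add: xy algebra_simps)
    moreover have "a + c \<in> F" "b + d \<in> F" "a * c + b * d * (s * s) \<in> F" "a * d + b * c \<in> F"
      using F4 s(1) cl(2,3) by simp_all
    ultimately show ?thesis by blast
  qed
  moreover have "inverse x \<in> ?E" if "x \<in> ?E" for x
  proof -
    from that obtain a b where F2: "a \<in> F" "b \<in> F" and x: "x = a + b * s" by auto
    \<comment> \<open>The norm of \<open>x\<close>, by which the denominator of \<open>1 / x\<close> is rationalised.\<close>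
    define D where "D = a * a - b * b * (s * s)"
    have D: "D \<in> F" unfolding D_def using F2 s(1) cl(3,4) by simp
    show ?thesis
    proof (cases "D = 0")
      case True
      hence "(a - b * s) * (a + b * s) = 0" by (simp add: D_def algebra_simps)
      hence "a = b * s \<or> a = - b * s" by auto
      moreover have "b = 0"
      proof (rule ccontr)
        assume "b \<noteq> 0"
        with \<open>a = b * s \<or> a = - b * s\<close> have "s = a / b \<or> s = (0 - a) / b" by auto
        thus False using s(2) cl(5)[OF F2] cl(5)[OF cl(4)[OF cl(1)[of 0] F2(1)] F2(2)] by auto
      qed
      ultimately show ?thesis using that x by simp
    next
      case False
      have "(a + b * s) * (a - b * s) = D" by (simp add: D_def algebra_simps)
      hence "x * ((a - b * s) / D) = 1" using False by (simp add: x)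
      hence "inverse x = (a - b * s) / D" by (rule inverse_unique)
      also have "\<dots> = a / D + ((0 - b) / D) * s" by (simp add: diff_divide_distrib)
      finally have "inverse x = a / D + ((0 - b) / D) * s" .
      moreover have "a / D \<in> F" "(0 - b) / D \<in> F"
        using F2 D cl(5) cl(4)[OF cl(1)[OF Rats_0]] by auto
      ultimately show ?thesis by blast
    qed
  qed
  ultimately show ?thesis by (auto simp: real_subfield_def)
qed

lemma sqrt_in_Rats_imp_even_multiplicity:
  assumes "r > 0" "sqrt (real r) \<in> \<rat>" "prime q"
  shows "even (multiplicity q r)"
proof -
  from assms(2) obtain a b :: nat where b: "b \<noteq> 0" and "\<bar>sqrt (real r)\<bar> = real a / real b"
    by (rule Rats_abs_nat_div_natE)
  hence "real a = sqrt (real r) * real b" by simp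
  hence "real a ^ 2 = real r * real b ^ 2" by (simp add: power_mult_distrib)
  hence eq: "a ^ 2 = r * b ^ 2" by (metis of_nat_eq_iff of_nat_mult of_nat_power)
  hence "a \<noteq> 0" using b assms(1) by (metis mult_eq_0_iff not_gr_zero power_eq_0_iff zero_power2)
  hence "2 * multiplicity q a = multiplicity q r + 2 * multiplicity q b"
    using arg_cong[OF eq, of "multiplicity q"] assms b
    by (simp add: prime_elem_multiplicity_mult_distrib prime_elem_multiplicity_power_distrib)
  thus ?thesis by presburger
qed

text \<open>
  The field generated by the square roots of the primes in \<open>S\<close> contains no square root of a
  natural number other than the obvious ones: adjoining \<open>\<surd>p\<close> to \<open>F\<close>, an element \<open>a + b \<surd>p\<close>
  with square in \<open>F\<close> has \<open>a = 0\<close> or \<open>b = 0\<close>, so that \<open>\<surd>r\<close> or \<open>\<surd>(r p)\<close> was already in \<open>F\<close>.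
  The primes of odd multiplicity in \<open>r\<close> are those of its square-free part; multiplicities make
  the passage from \<open>r p\<close> to \<open>r\<close> immediate.
\<close>
lemma field_of_prime_sqrts:
  assumes "finite S" "\<And>p. p \<in> S \<Longrightarrow> prime (p :: nat)"
  shows "\<exists>F. real_subfield F \<and> (\<forall>p\<in>S. sqrt (real p) \<in> F) \<and>
    (\<forall>r q. r > 0 \<and> sqrt (real r) \<in> F \<and> prime q \<and> odd (multiplicity q r) \<longrightarrow> q \<in> S)"
  using assms
proof (induction S rule: finite_induct)
  case empty
  show ?case
    using real_subfield_Rats sqrt_in_Rats_imp_even_multiplicity by (intro exI[of _ \<rat>]) blast
next
  case (insert p S)
  have S: "\<And>q. q \<in> S \<Longrightarrow> prime q" using insert.prems by simp
  obtain F where F: "real_subfield F" and Fs: "\<And>p. p \<in> S \<Longrightarrow> sqrt (real p) \<in> F"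
    and odd: "\<And>r q. r > 0 \<Longrightarrow> sqrt (real r) \<in> F \<Longrightarrow> prime q \<Longrightarrow> odd (multiplicity q r) \<Longrightarrow> q \<in> S"
    using insert.IH[OF S] by blast
  note cl = real_subfieldD[OF F]
  have p: "prime p" using insert.prems by simp
  define s where "s = sqrt (real p)"
  have ss: "s * s = real p" by (simp add: s_def)
  have sF: "s \<notin> F" using odd[of p p] p insert.hyps by (auto simp: s_def prime_gt_0_nat)
  define E where "E = {a + b * s | a b. a \<in> F \<and> b \<in> F}"
  have mem_E: "a + b * s \<in> E" if "a \<in> F" "b \<in> F" for a b using that by (auto simp: E_def)
  have "real_subfield E" unfolding E_def
    by (rule real_subfield_adjoin_sqrt[OF F _ sF]) (simp add: ss cl(1))
  moreover have "sqrt (real q) \<in> E" if "q \<in> insert p S" for q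
  proof (cases "q = p")
    case True
    thus ?thesis using mem_E[of 0 1] cl(1)[of 0] cl(1)[of 1] by (simp add: s_def)
  next
    case False
    thus ?thesis using mem_E[of "sqrt (real q)" 0] Fs[of q] that cl(1)[of 0] by simp
  qed
  moreover have "q \<in> insert p S"
    if r: "r > 0" "sqrt (real r) \<in> E" and q: "prime q" "odd (multiplicity q r)" for r q
  proof -
    from r obtain a b where ab: "a \<in> F" "b \<in> F" and eq: "sqrt (real r) = a + b * s"
      by (auto simp: E_def)
    have "real r = (a + b * s) * (a + b * s)" by (simp flip: eq)
    also have "\<dots> = a * a + b * b * (s * s) + 2 * a * b * s" by (simp add: algebra_simps)
    finally have "2 * a * b * s = real r - (a * a + b * b * real p)" by (simp add: ss)
    moreover have "real r - (a * a + b * b * real p) \<in> F" "2 * a * b \<in> F"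
      using cl(1)[of "real r"] cl(1)[of "real p"] cl(1)[of 2] ab cl(2-4) by simp_all
    ultimately have "2 * a * b * s / (2 * a * b) \<in> F" using cl(5) by simp
    hence "a * b = 0" using sF by (cases "a * b = 0") auto
    hence "a = 0 \<or> b = 0" by simp
    thus ?thesis
    proof
      assume "b = 0"
      thus ?thesis using odd[of r q] r q ab eq by simp
    next
      assume "a = 0"
      hence "sqrt (real (r * p)) = b * real p" using ss by (simp add: real_sqrt_mult eq s_def)
      hence rp: "sqrt (real (r * p)) \<in> F" using ab cl(1,3) by simp
      show ?thesis
      proof (cases "q = p")
        case False
        have "multiplicity q (r * p) = multiplicity q r"
          using r p q False
          by (simp add: prime_elem_multiplicity_mult_distrib prime_multiplicity_other prime_gt_0_nat)
        thus ?thesis using odd[of "r * p" q] rp q r p by (simp add: prime_gt_0_nat)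
      qed simp
    qed
  qed
  ultimately show ?case by (intro exI[of _ E]) auto
qed

lemma sqrt_in_field_of_prime_sqrts:
  assumes F: "real_subfield F" and S: "\<And>p. p \<in> S \<Longrightarrow> sqrt (real p) \<in> F"
  shows "d > 0 \<Longrightarrow> prime_factors d \<subseteq> S \<Longrightarrow> sqrt (real d) \<in> F"
proof (induction d rule: less_induct)
  case (less d)
  show ?case
  proof (cases "d = 1")
    case True
    thus ?thesis using real_subfieldD(1)[OF F] by simp
  next
    case False
    then obtain p where p: "prime p" "p dvd d" using prime_factor_nat by blast
    then obtain e where e: "d = p * e" by auto
    have "sqrt (real e) \<in> F"
      using less.prems p prime_gt_1_nat[of p]
      by (intro less.IH) (auto simp: e prime_factors_dvd)
    moreover have "sqrt (real p) \<in> F" using p less.prems by (intro S) (auto simp: prime_factors_dvd)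
    ultimately show ?thesis using real_subfieldD(3)[OF F] by (simp add: e real_sqrt_mult)
  qed
qed

text \<open>
  Induction on the set \<open>S\<close> of primes that may occur. For a further prime \<open>p\<close>, collecting the terms
  with \<open>p dvd d i\<close> turns the relation into \<open>A + B \<surd>p = 0\<close> with \<open>A\<close> and \<open>B\<close> in the field of the
  square roots of the other primes. As \<open>\<surd>p\<close> lies outside this field, \<open>A = B = 0\<close>, and these are two
  relations for \<open>S\<close>.
\<close>
lemma sqrt_squarefree_linear_independent:
  fixes d :: "'i \<Rightarrow> nat"
  assumes "finite S" "\<And>p. p \<in> S \<Longrightarrow> prime p"
    and "finite I" "inj_on d I" "\<And>i. i \<in> I \<Longrightarrow> squarefree (d i)"
    and "\<And>i. i \<in> I \<Longrightarrow> prime_factors (d i) \<subseteq> S"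
    and "\<And>i. i \<in> I \<Longrightarrow> c i \<in> \<rat>" "(\<Sum>i\<in>I. c i * sqrt (real (d i))) = 0"
  shows "\<forall>i\<in>I. c i = 0"
  using assms
proof (induction S arbitrary: I d rule: finite_induct)
  case (empty I d)
  have d1: "d i = 1" if "i \<in> I" for i
    using empty.prems(4,5)[OF that] prime_factor_nat[of "d i"]
    by (cases "d i = 0") (auto simp: prime_factors_dvd)
  show ?case
  proof
    fix i assume i: "i \<in> I"
    hence "I = {i}" using d1 empty.prems(3) by (auto simp: inj_on_def)
    thus "c i = 0" using empty.prems(7) d1 by simp
  qed
next
  case (insert p S I d)
  note sqf = insert.prems(4)
  have S: "\<And>q. q \<in> S \<Longrightarrow> prime q" and p: "prime p" using insert.prems(1) by auto
  obtain F where F: "real_subfield F" and Fs: "\<And>q. q \<in> S \<Longrightarrow> sqrt (real q) \<in> F"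
    and odd: "\<And>r q. r > 0 \<Longrightarrow> sqrt (real r) \<in> F \<Longrightarrow> prime q \<Longrightarrow> odd (multiplicity q r) \<Longrightarrow> q \<in> S"
    using field_of_prime_sqrts[OF insert.hyps(1) S] by auto
  have pF: "sqrt (real p) \<notin> F" using odd[of p p] p insert.hyps by (auto simp: prime_gt_0_nat)
  define I0 I1 where "I0 = {i\<in>I. \<not> p dvd d i}" and "I1 = {i\<in>I. p dvd d i}"
  define e where "e i = d i div p" for i
  have de: "d i = p * e i" if "i \<in> I1" for i using that by (auto simp: e_def I1_def)
  have pos: "d i > 0" if "i \<in> I" for i using sqf[OF that] by (cases "d i = 0") auto
  have pf0: "prime_factors (d i) \<subseteq> S" if "i \<in> I0" for i
    using insert.prems(5)[of i] that by (auto simp: I0_def prime_factors_dvd)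
  have e: "e i > 0" "squarefree (e i)" "prime_factors (e i) \<subseteq> S" if "i \<in> I1" for i
  proof -
    have i: "i \<in> I" using that by (auto simp: I1_def)
    show "e i > 0" using pos[OF i] de[OF that] by auto
    show "squarefree (e i)" using sqf[OF i] de[OF that] squarefree_multD(2) by metis
    have "\<not> p dvd e i"
    proof
      assume "p dvd e i"
      hence "p ^ 2 dvd d i" using de[OF that] by (simp add: power2_eq_square)
      thus False using squarefreeD[OF sqf[OF i]] p by (metis not_prime_unit)
    qed
    thus "prime_factors (e i) \<subseteq> S"
      using insert.prems(5)[OF i] pos[OF i] de[OF that] by (auto simp: prime_factors_dvd)
  qed
  define A B where "A = (\<Sum>i\<in>I0. c i * sqrt (real (d i)))" and "B = (\<Sum>i\<in>I1. c i * sqrt (real (e i)))"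
  have fin: "finite I0" "finite I1" using insert.prems(2) by (auto simp: I0_def I1_def)
  have "I = I0 \<union> I1" "I0 \<inter> I1 = {}" by (auto simp: I0_def I1_def)
  hence "0 = A + (\<Sum>i\<in>I1. c i * sqrt (real (d i)))"
    using insert.prems(7) fin by (simp add: sum.union_disjoint A_def)
  also have "(\<Sum>i\<in>I1. c i * sqrt (real (d i))) = B * sqrt (real p)"
    unfolding B_def sum_distrib_right
    by (rule sum.cong) (simp_all add: de real_sqrt_mult)
  finally have AB: "A + B * sqrt (real p) = 0" by simp
  have cF: "c i \<in> F" if "i \<in> I" for i
    using insert.prems(6)[OF that] real_subfieldD(1)[OF F] by simp
  have AF: "A \<in> F" unfolding A_def
    using pf0 pos cF
    by (intro real_subfield_sum[OF F] real_subfieldD(3)[OF F] sqrt_in_field_of_prime_sqrts[OF F Fs])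
       (auto simp: I0_def)
  have BF: "B \<in> F" unfolding B_def
    using e cF
    by (intro real_subfield_sum[OF F] real_subfieldD(3)[OF F] sqrt_in_field_of_prime_sqrts[OF F Fs])
       (auto simp: I1_def)
  have B0: "B = 0"
  proof (rule ccontr)
    assume "B \<noteq> 0"
    hence "sqrt (real p) = (0 - A) / B" using AB by (simp add: field_simps)
    thus False
      using pF real_subfieldD(5)[OF F real_subfieldD(4)[OF F real_subfieldD(1)[OF F Rats_0] AF] BF]
      by simp
  qed
  hence A0: "A = 0" using AB by simp
  have "\<forall>i\<in>I0. c i = 0"
    using insert.prems(3,4,6) pf0 A0 fin(1)
    by (intro insert.IH[of I0 d] S) (auto simp: I0_def A_def intro: inj_on_subset)
  moreover have "\<forall>i\<in>I1. c i = 0"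
  proof (rule insert.IH[of I1 e, OF S fin(2)])
    show "inj_on e I1"
    proof (rule inj_onI)
      fix i j assume ij: "i \<in> I1" "j \<in> I1" "e i = e j"
      hence "d i = d j" by (simp add: de)
      thus "i = j" using insert.prems(3) ij by (auto simp: inj_on_def I1_def)
    qed
  qed (use e insert.prems(6) B0 in \<open>auto simp: I1_def B_def\<close>)
  ultimately show ?case by (auto simp: I0_def I1_def)
qed

theorem sqrt_linear_independent:
  fixes a :: "'i \<Rightarrow> nat"
  assumes "finite I" and pos: "\<And>i. i \<in> I \<Longrightarrow> a i > 0"
    and inj: "inj_on (\<lambda>i. squarefree_part (a i)) I"
    and rat: "\<And>i. i \<in> I \<Longrightarrow> c i \<in> \<rat>" and zero: "(\<Sum>i\<in>I. c i * sqrt (real (a i))) = 0"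
    and i: "i \<in> I"
  shows "c i = 0"
proof -
  define S where "S = (\<Union>i\<in>I. prime_factors (squarefree_part (a i)))"
  have "\<forall>i\<in>I. c i * real (square_part (a i)) = 0"
  proof (rule sqrt_squarefree_linear_independent[where S = S, OF _ _ assms(1) inj])
    have "sqrt (real (a i)) = real (square_part (a i)) * sqrt (real (squarefree_part (a i)))" for i
      by (subst squarefree_decompose[of "a i"]) (simp add: real_sqrt_mult)
    thus "(\<Sum>i\<in>I. c i * real (square_part (a i)) * sqrt (real (squarefree_part (a i)))) = 0"
      using zero by (simp add: mult.assoc)
  qed (use assms(1) rat in \<open>auto simp: S_def\<close>)
  thus ?thesis using i pos[OF i] by auto
qed

section \<open>The product over all choices of signs\<close>

text \<open>
  The sums \<open>t \<plusminus> x\<^sub>1 \<plusminus> \<dots> \<plusminus> x\<^sub>n\<close>. They form a list and not a set, because sums that coincide for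
  different choices of signs are separate factors of the product.
\<close>
fun signed_sums :: "real \<Rightarrow> real list \<Rightarrow> real list" where
  "signed_sums t [] = [t]"
| "signed_sums t (x # xs) = signed_sums (t + x) xs @ signed_sums (t - x) xs"

lemma length_signed_sums: "length (signed_sums t xs) = 2 ^ length xs"
  by (induction t xs rule: signed_sums.induct) auto

lemma signed_sums_eq_Cons: "\<exists>ys. signed_sums t xs = (t + sum_list xs) # ys"
proof (induction t xs rule: signed_sums.induct)
  case (2 t x xs)
  then show ?case by (auto simp: add.assoc)
qed auto

lemma sum_squares_signed_sums:
  "(\<Sum>y\<leftarrow>signed_sums t xs. y\<^sup>2) = 2 ^ length xs * (t\<^sup>2 + (\<Sum>x\<leftarrow>xs. x\<^sup>2))"
proof (induction t xs rule: signed_sums.induct)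
  case (2 t x xs)
  then show ?case by (simp add: power2_eq_square algebra_simps)
qed auto

lemma in_signed_sumsE:
  assumes "y \<in> set (signed_sums t (map f ns))" "distinct ns"
  obtains \<epsilon> :: "'a \<Rightarrow> int" where "\<And>n. \<bar>\<epsilon> n\<bar> = 1" "y = t + (\<Sum>n\<in>set ns. of_int (\<epsilon> n) * f n)"
proof -
  have "\<exists>\<epsilon> :: 'a \<Rightarrow> int. (\<forall>n. \<bar>\<epsilon> n\<bar> = 1) \<and> y = t + (\<Sum>n\<in>set ns. of_int (\<epsilon> n) * f n)"
    using assms
  proof (induction ns arbitrary: t)
    case Nil
    thus ?case by (intro exI[of _ "\<lambda>_. 1"]) auto
  next
    case (Cons k ns)
    have "\<exists>\<sigma>::int. \<bar>\<sigma>\<bar> = 1 \<and> y \<in> set (signed_sums (t + of_int \<sigma> * f k) (map f ns))"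
      using Cons.prems(1) by (auto intro: exI[of _ 1] exI[of _ "-1"])
    then obtain \<sigma> :: int where \<sigma>: "\<bar>\<sigma>\<bar> = 1"
      and y: "y \<in> set (signed_sums (t + of_int \<sigma> * f k) (map f ns))" by blast
    obtain \<epsilon> :: "'a \<Rightarrow> int" where \<epsilon>: "\<And>n. \<bar>\<epsilon> n\<bar> = 1"
      and eq: "y = t + of_int \<sigma> * f k + (\<Sum>n\<in>set ns. of_int (\<epsilon> n) * f n)"
      using Cons.IH[OF y] Cons.prems(2) by auto
    have "(\<Sum>n\<in>set ns. of_int ((\<epsilon>(k := \<sigma>)) n) * f n) = (\<Sum>n\<in>set ns. of_int (\<epsilon> n) * f n)"
      using Cons.prems(2) by (intro sum.cong) auto
    hence "y = t + (\<Sum>n\<in>set (k # ns). of_int ((\<epsilon>(k := \<sigma>)) n) * f n)"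
      using Cons.prems(2) eq by (simp del: fun_upd_apply) simp
    thus ?case using \<epsilon> \<sigma> by (intro exI[of _ "\<epsilon>(k := \<sigma>)"]) auto
  qed
  thus ?thesis using that by blast
qed

text \<open>
  The functions \<open>t \<mapsto> p t\<close> for \<open>p \<in> \<int>[t]\<close>. Generating them from constants and the identity makes
  the shift by the square root of an integer, which is all that the proof does with them, a plain
  induction without coefficients.
\<close>
inductive_set int_poly_funs :: "(real \<Rightarrow> real) set" where
  const: "k \<in> \<int> \<Longrightarrow> (\<lambda>_. k) \<in> int_poly_funs"
| ident: "(\<lambda>t. t) \<in> int_poly_funs"
| add: "f \<in> int_poly_funs \<Longrightarrow> g \<in> int_poly_funs \<Longrightarrow> (\<lambda>t. f t + g t) \<in> int_poly_funs"
| mult: "f \<in> int_poly_funs \<Longrightarrow> g \<in> int_poly_funs \<Longrightarrow> (\<lambda>t. f t * g t) \<in> int_poly_funs"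

lemma int_poly_funs_Ints: "f \<in> int_poly_funs \<Longrightarrow> k \<in> \<int> \<Longrightarrow> f k \<in> \<int>"
  by (induction rule: int_poly_funs.induct) auto

text \<open>
  The even powers of \<open>x\<close> in \<open>f (t + x)\<close> are integers, so \<open>f (t + x)\<close> lies in \<open>\<int>[t] + x \<int>[t]\<close>;
  replacing \<open>x\<close> by \<open>-x\<close> is conjugation.
\<close>
lemma int_poly_funs_shift:
  assumes "f \<in> int_poly_funs" "x\<^sup>2 \<in> \<int>"
  obtains g h where "g \<in> int_poly_funs" "h \<in> int_poly_funs"
    "\<And>t. f (t + x) = g t + x * h t" "\<And>t. f (t - x) = g t - x * h t"
proof -
  have "\<exists>g\<in>int_poly_funs. \<exists>h\<in>int_poly_funs. \<forall>t. f (t + x) = g t + x * h t \<and> f (t - x) = g t - x * h t"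
    using assms(1)
  proof (induction rule: int_poly_funs.induct)
    case (const k)
    thus ?case
      by (intro bexI[of _ "\<lambda>_. k"] bexI[of _ "\<lambda>_. 0"]) (auto intro: int_poly_funs.const)
  next
    case ident
    thus ?case
      by (intro bexI[of _ "\<lambda>t. t"] bexI[of _ "\<lambda>_. 1"]) (auto intro: int_poly_funs.intros)
  next
    case (add f1 f2)
    then obtain g1 h1 g2 h2 where gh: "g1 \<in> int_poly_funs" "h1 \<in> int_poly_funs"
      "g2 \<in> int_poly_funs" "h2 \<in> int_poly_funs"
      and f: "\<And>t. f1 (t + x) = g1 t + x * h1 t" "\<And>t. f1 (t - x) = g1 t - x * h1 t"
        "\<And>t. f2 (t + x) = g2 t + x * h2 t" "\<And>t. f2 (t - x) = g2 t - x * h2 t" by metis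
    let ?g = "\<lambda>t. g1 t + g2 t" and ?h = "\<lambda>t. h1 t + h2 t"
    have "?g \<in> int_poly_funs" "?h \<in> int_poly_funs"
      by (intro int_poly_funs.add int_poly_funs.mult int_poly_funs.const assms(2) gh)+
    thus ?case
      by (intro rev_bexI[of ?g] rev_bexI[of ?h]) (simp_all add: f algebra_simps power2_eq_square)
  next
    case (mult f1 f2)
    then obtain g1 h1 g2 h2 where gh: "g1 \<in> int_poly_funs" "h1 \<in> int_poly_funs"
      "g2 \<in> int_poly_funs" "h2 \<in> int_poly_funs"
      and f: "\<And>t. f1 (t + x) = g1 t + x * h1 t" "\<And>t. f1 (t - x) = g1 t - x * h1 t"
        "\<And>t. f2 (t + x) = g2 t + x * h2 t" "\<And>t. f2 (t - x) = g2 t - x * h2 t" by metis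
    let ?g = "\<lambda>t. g1 t * g2 t + x\<^sup>2 * (h1 t * h2 t)" and ?h = "\<lambda>t. g1 t * h2 t + h1 t * g2 t"
    have "?g \<in> int_poly_funs" "?h \<in> int_poly_funs"
      by (intro int_poly_funs.add int_poly_funs.mult int_poly_funs.const assms(2) gh)+
    thus ?case
      by (intro rev_bexI[of ?g] rev_bexI[of ?h]) (simp_all add: f algebra_simps power2_eq_square)
  qed
  thus ?thesis using that by blast
qed

lemma prod_signed_sums_int_poly_funs:
  assumes "\<And>x. x \<in> set xs \<Longrightarrow> x\<^sup>2 \<in> \<int>"
  shows "(\<lambda>t. prod_list (signed_sums t xs)) \<in> int_poly_funs"
  using assms
proof (induction xs)
  case Nil
  thus ?case by (simp add: int_poly_funs.ident)
next
  case (Cons x xs)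
  have x: "x\<^sup>2 \<in> \<int>" using Cons.prems by simp
  obtain g h where gh: "g \<in> int_poly_funs" "h \<in> int_poly_funs"
    "\<And>t. prod_list (signed_sums (t + x) xs) = g t + x * h t"
    "\<And>t. prod_list (signed_sums (t - x) xs) = g t - x * h t"
    using int_poly_funs_shift[OF Cons.IH x] Cons.prems by auto
  have "(\<lambda>t. prod_list (signed_sums t (x # xs))) = (\<lambda>t. g t * g t + (- x\<^sup>2) * (h t * h t))"
    by (simp add: gh algebra_simps power2_eq_square)
  also have "\<dots> \<in> int_poly_funs"
    by (intro int_poly_funs.intros gh) (use x in auto)
  finally show ?case .
qed

text \<open>
  Changing the sign of \<open>t\<close> permutes the factors up to sign, and for nonempty \<open>xs\<close> their number
  is even.
\<close>
lemma prod_signed_sums_uminus: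
  "xs \<noteq> [] \<Longrightarrow> prod_list (signed_sums (- t) xs) = prod_list (signed_sums t xs)"
proof (induction xs arbitrary: t rule: list_nonempty_induct)
  case (single x)
  show ?case by (simp add: algebra_simps)
next
  case (cons x xs)
  show ?case
    using cons.IH[of "t - x"] cons.IH[of "t + x"] by (simp add: algebra_simps)
qed

text \<open>
  Write the product as \<open>A + t B\<close> with integers \<open>A\<close> and \<open>B\<close>. Its value at \<open>-t\<close> is \<open>A - t B\<close>, and it is
  even in \<open>t\<close>, hence equal to \<open>A\<close>.
\<close>
lemma prod_signed_sums_Ints:
  assumes "xs \<noteq> []" "t\<^sup>2 \<in> \<int>" "\<And>x. x \<in> set xs \<Longrightarrow> x\<^sup>2 \<in> \<int>"
  shows "prod_list (signed_sums t xs) \<in> \<int>"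
proof -
  obtain g h where g: "g \<in> int_poly_funs"
    and p: "\<And>s. prod_list (signed_sums (s + t) xs) = g s + t * h s"
    and m: "\<And>s. prod_list (signed_sums (s - t) xs) = g s - t * h s"
    using int_poly_funs_shift[OF prod_signed_sums_int_poly_funs[OF assms(3)] assms(2)] by metis
  have "t * h 0 = 0"
    using p[of 0] m[of 0] prod_signed_sums_uminus[OF assms(1), of t] by simp
  hence "prod_list (signed_sums t xs) = g 0" using p[of 0] by simp
  thus ?thesis using int_poly_funs_Ints[OF g, of 0] by simp
qed

section \<open>The lower bound\<close>

lemma prod_list_le_mean_power:
  fixes ys :: "real list"
  assumes "ys \<noteq> []" "\<And>y. y \<in> set ys \<Longrightarrow> y \<ge> 0"
  shows "prod_list ys \<le> (sum_list ys / length ys) ^ length ys"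
proof -
  let ?n = "length ys"
  have n: "?n > 0" using assms(1) by simp
  have P: "prod_list ys = (\<Prod>i\<in>{0..<?n}. ys ! i)" and \<Sigma>: "sum_list ys = (\<Sum>i\<in>{0..<?n}. ys ! i)"
    by (simp_all add: sum_list_sum_nth prod.list_conv_set_nth)
  have P0: "prod_list ys \<ge> 0" unfolding P using assms(2) by (intro prod_nonneg) auto
  have "prod_list ys powr (1 / ?n) \<le> sum_list ys / ?n"
    unfolding P \<Sigma> sum_divide_distrib
    using arith_geom_mean[of "{0..<?n}" "\<lambda>i. ys ! i"] assms n by auto
  hence "(prod_list ys powr (1 / ?n)) ^ ?n \<le> (sum_list ys / ?n) ^ ?n"
    by (intro power_mono) auto
  also have "(prod_list ys powr (1 / ?n)) ^ ?n = prod_list ys"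
    using n P0 by (cases "prod_list ys = 0") (auto simp: powr_powr simp flip: powr_realpow)
  finally show ?thesis .
qed

lemma one_le_prod_squares_signed_sums:
  assumes "xs \<noteq> []" "t\<^sup>2 \<in> \<int>" "\<And>x. x \<in> set xs \<Longrightarrow> x\<^sup>2 \<in> \<int>"
    and "0 \<notin> set (signed_sums t xs)"
  shows "1 \<le> (\<Prod>y\<leftarrow>signed_sums t xs. y\<^sup>2)"
proof -
  let ?P = "prod_list (signed_sums t xs)"
  have "?P \<noteq> 0" using assms(4) by (simp add: prod_list_zero_iff)
  hence "1 \<le> \<bar>?P\<bar>" using Ints_nonzero_abs_ge1 prod_signed_sums_Ints[OF assms(1-3)] by blast
  hence "1 \<le> ?P\<^sup>2" using abs_le_square_iff[of 1 ?P] by simp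
  also have "(prod_list ys)\<^sup>2 = (\<Prod>y\<leftarrow>ys. y\<^sup>2)" for ys :: "real list"
    by (induction ys) (auto simp: power_mult_distrib)
  finally show ?thesis .
qed

text \<open>
  If one factor of the nonzero integer \<open>prod_list (signed_sums t xs)\<close> were too small, the \<open>N\<close> others
  would have to be large on average, but their mean square is controlled by
  \<open>sum_squares_signed_sums\<close>.
\<close>
lemma abs_sum_ge:
  fixes t :: real and xs :: "real list"
  defines "N \<equiv> 2 ^ length xs - 1 :: real"
  assumes ne: "xs \<noteq> []" and int: "t\<^sup>2 \<in> \<int>" "\<And>x. x \<in> set xs \<Longrightarrow> x\<^sup>2 \<in> \<int>"
    and nz: "0 \<notin> set (signed_sums t xs)"
  shows "\<bar>t + sum_list xs\<bar> \<ge> (2 ^ length xs / N * (t\<^sup>2 + (\<Sum>x\<leftarrow>xs. x\<^sup>2))) powr (- (N / 2))"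
proof -
  define B where "B = 2 ^ length xs / N * (t\<^sup>2 + (\<Sum>x\<leftarrow>xs. x\<^sup>2))"
  define L where "L = t + sum_list xs"
  obtain ys where ys: "signed_sums t xs = L # ys" using signed_sums_eq_Cons L_def by blast
  have len: "Suc (length ys) = 2 ^ length xs" using length_signed_sums[of t xs] ys by simp
  hence N: "real (length ys) = N"
    unfolding N_def by (metis add_diff_cancel_left' of_nat_Suc of_nat_numeral of_nat_power)
  have "(2::nat) ^ 1 \<le> 2 ^ length xs" using ne by (intro power_increasing) (auto simp: Suc_leI)
  hence ys_ne: "ys \<noteq> []" using len by auto
  hence N0: "N > 0" using N by (metis length_greater_0_conv of_nat_0_less_iff)
  have L0: "L \<noteq> 0" using nz ys by auto
  have "L\<^sup>2 + (\<Sum>y\<leftarrow>ys. y\<^sup>2) = 2 ^ length xs * (t\<^sup>2 + (\<Sum>x\<leftarrow>xs. x\<^sup>2))"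
    using sum_squares_signed_sums[of t xs] ys by simp
  hence "(\<Sum>y\<leftarrow>ys. y\<^sup>2) \<le> 2 ^ length xs * (t\<^sup>2 + (\<Sum>x\<leftarrow>xs. x\<^sup>2))"
    using zero_le_power2[of L] by linarith
  hence mean: "(\<Sum>y\<leftarrow>ys. y\<^sup>2) / N \<le> B"
    using N0 by (simp add: B_def divide_right_mono)
  have sq0: "(\<Sum>y\<leftarrow>ys. y\<^sup>2) \<ge> 0" by (rule sum_list_nonneg) auto
  have "1 \<le> L\<^sup>2 * (\<Prod>y\<leftarrow>ys. y\<^sup>2)"
    using one_le_prod_squares_signed_sums[OF ne int nz] ys by simp
  also have "(\<Prod>y\<leftarrow>ys. y\<^sup>2) \<le> ((\<Sum>y\<leftarrow>ys. y\<^sup>2) / N) ^ length ys"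
    using prod_list_le_mean_power[of "map (\<lambda>y. y\<^sup>2) ys"] ys_ne N by fastforce
  also have "\<dots> \<le> B ^ length ys"
    using mean sq0 N0 by (intro power_mono) auto
  finally have one: "1 \<le> L\<^sup>2 * B ^ length ys" by (simp add: mult_left_mono)
  have "0 \<le> B" using mean sq0 N0 by (meson divide_nonneg_pos order_trans)
  moreover have "B \<noteq> 0" using one ys_ne by (auto simp: power_0_left)
  ultimately have B0: "B > 0" by simp
  have "(B powr (- (N / 2)))\<^sup>2 = B powr (- N)"
    by (simp add: power2_eq_square flip: powr_add)
  also have "\<dots> = 1 / B ^ length ys"
    using B0 by (simp add: powr_minus_divide powr_realpow flip: N)
  also have "\<dots> \<le> L\<^sup>2" using one B0 by (simp add: divide_simps)
  finally have "B powr (- (N / 2)) \<le> \<bar>L\<bar>"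
    using abs_le_square_iff[of "B powr (- (N / 2))" L] by simp
  thus ?thesis by (simp add: B_def L_def)
qed

theorem proposition2p2:
  fixes K :: nat and a :: "nat \<Rightarrow> nat" and m :: "nat \<Rightarrow> int" and \<Lambda> C\<^sub>K :: real
  assumes "K \<ge> 2"
    and "\<And>n. n \<in> {1..K} \<Longrightarrow> a n > 0"
    and "inj_on (\<lambda>n. squarefree_part (a n)) {1..K}"
    and "\<exists>n\<in>{1..K}. m n \<noteq> 0"
    and "\<Lambda> = \<bar>\<Sum>n=1..K. real_of_int (m n) * sqrt (real (a n))\<bar>"
    and "C\<^sub>K = (1 - 2 powr (1 - real K)) powr ((2 ^ (K - 1) - 1) / 2)"
  shows "\<Lambda> \<ge> (1 / (1 - 2 powr (1 - real K)) *
            (\<Sum>n=1..K. (real_of_int (m n))\<^sup>2 * real (a n))) powr (- ((2 ^ (K - 1) - 1) / 2))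
    \<and> \<Lambda> \<ge> C\<^sub>K * (Max ((\<lambda>n. \<bar>real_of_int (m n)\<bar> * sqrt (real (a n))) ` {1..K}) *
            sqrt (real K)) powr (- (2 ^ (K - 1) - 1))"
proof -
  define x where "x n = real_of_int (m n) * sqrt (real (a n))" for n
  define N :: real where "N = 2 ^ (K - 1) - 1"
  define c where "c = 1 - 2 powr (1 - real K)"
  define Q where "Q = (\<Sum>n=1..K. (real_of_int (m n))\<^sup>2 * real (a n))"
  define M where "M = Max ((\<lambda>n. \<bar>real_of_int (m n)\<bar> * sqrt (real (a n))) ` {1..K})"
  let ?xs = "map x [2..<Suc K]"
  have x2: "(x n)\<^sup>2 = (real_of_int (m n))\<^sup>2 * real (a n)" for n
    by (simp add: x_def power_mult_distrib)
  have x2_Ints: "(x n)\<^sup>2 \<in> \<int>" for n by (simp add: x2)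
  have len: "length ?xs = K - 1" by (simp del: upt_Suc)
  have set: "{1..K} = insert 1 (set [2..<Suc K])" "1 \<notin> set [2..<Suc K]" using assms(1) by auto
  have sum_xs: "(\<Sum>n=1..K. f n) = f 1 + (\<Sum>n\<leftarrow>[2..<Suc K]. f n)" for f :: "nat \<Rightarrow> real"
  proof -
    have "(\<Sum>n\<leftarrow>[2..<Suc K]. f n) = (\<Sum>n\<in>set [2..<Suc K]. f n)"
      by (rule sum_list_distinct_conv_sum_set) simp
    thus ?thesis unfolding set(1) using set(2) by (simp del: upt_Suc set_upt)
  qed
  have nz: "0 \<notin> set (signed_sums (x 1) ?xs)"
  proof
    assume "0 \<in> set (signed_sums (x 1) ?xs)"
    then obtain \<epsilon> :: "nat \<Rightarrow> int" where \<epsilon>: "\<And>n. \<bar>\<epsilon> n\<bar> = 1"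
      and eq: "0 = x 1 + (\<Sum>n\<in>set [2..<Suc K]. of_int (\<epsilon> n) * x n)"
      using in_signed_sumsE[OF _ distinct_upt] by blast
    \<comment> \<open>The sign of \<open>x 1\<close> is fixed, whatever value \<open>\<epsilon>\<close> takes outside the list.\<close>
    define \<delta> where "\<delta> = \<epsilon>(1 := 1)"
    have \<delta>: "\<bar>\<delta> n\<bar> = 1" for n using \<epsilon> by (simp add: \<delta>_def)
    have "(\<Sum>n\<in>set [2..<Suc K]. of_int (\<epsilon> n) * x n) = (\<Sum>n\<in>set [2..<Suc K]. of_int (\<delta> n) * x n)"
      using set(2) by (intro sum.cong) (auto simp: \<delta>_def)
    hence "(\<Sum>n\<in>{1..K}. of_int (\<delta> n) * x n) = 0"
      unfolding set(1) using set(2) eq by (subst sum.insert) (simp_all add: \<delta>_def)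
    hence "(\<Sum>n\<in>{1..K}. real_of_int (\<delta> n * m n) * sqrt (real (a n))) = 0"
      by (simp add: x_def mult.assoc)
    hence "real_of_int (\<delta> n * m n) = 0" if "n \<in> {1..K}" for n
      using sqrt_linear_independent[OF finite_atLeastAtMost assms(2,3), of "\<lambda>n. real_of_int (\<delta> n * m n)" n] that
      by simp
    thus False using assms(4) \<delta> by (metis abs_0 mult_eq_0_iff of_int_eq_0_iff zero_neq_one)
  qed
  have "2 powr (1 - real K) = 2 powr (- real (K - 1))" using assms(1) by (simp add: of_nat_diff)
  also have "\<dots> = 1 / 2 ^ (K - 1)" by (simp add: powr_minus_divide powr_realpow)
  finally have "2 powr (1 - real K) = 1 / 2 ^ (K - 1)" .
  hence c: "c = N / 2 ^ (K - 1)" by (simp add: c_def N_def field_simps)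
  have "(2::real) ^ 1 \<le> 2 ^ (K - 1)" using assms(1) by (intro power_increasing) auto
  hence N0: "N > 0" by (simp add: N_def)
  have c0: "c > 0" using c N0 by simp
  have \<Lambda>: "\<Lambda> = \<bar>x 1 + sum_list ?xs\<bar>"
    unfolding assms(5) x_def[symmetric] sum_xs[of x] ..
  have Q: "Q = (x 1)\<^sup>2 + (\<Sum>y\<leftarrow>?xs. y\<^sup>2)"
    using sum_xs[of "\<lambda>n. (x n)\<^sup>2"] by (simp add: Q_def x2 o_def del: upt_Suc)
  have ne: "?xs \<noteq> []" using assms(1) by simp
  have int: "y\<^sup>2 \<in> \<int>" if "y \<in> set ?xs" for y using that x2_Ints by auto
  have "\<Lambda> \<ge> (2 ^ (K - 1) / N * Q) powr (- (N / 2))"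
    using abs_sum_ge[OF ne x2_Ints int nz] unfolding len \<Lambda> Q N_def .
  hence first: "\<Lambda> \<ge> (1 / c * Q) powr (- (N / 2))" by (simp add: c)

  have le_M: "\<bar>x n\<bar> \<le> M" if "n \<in> {1..K}" for n
    unfolding M_def x_def using that by (intro Max_ge) (auto simp: abs_mult)
  obtain k where k: "k \<in> {1..K}" "m k \<noteq> 0" using assms(4) by auto
  have "x k \<noteq> 0" using k assms(2)[of k] by (simp add: x_def)
  hence Q0: "Q > 0"
    using k unfolding Q_def x2[symmetric] by (intro sum_pos2[of _ k]) auto
  have M0: "M > 0" using le_M[OF k(1)] \<open>x k \<noteq> 0\<close> by linarith
  have "(x n)\<^sup>2 \<le> M\<^sup>2" if "n \<in> {1..K}" for n
    using power_mono[OF le_M[OF that] abs_ge_zero, of 2] by simp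
  hence "Q \<le> (\<Sum>n=1..K. M\<^sup>2)" unfolding Q_def x2[symmetric] by (intro sum_mono)
  hence QM: "Q \<le> (M * sqrt (real K))\<^sup>2" by (simp add: power_mult_distrib mult.commute)
  define R where "R = M * sqrt (real K)"
  have R0: "R > 0" using M0 assms(1) by (simp add: R_def)
  have "c powr (N / 2) * R powr (- N) = (1 / c * R\<^sup>2) powr (- (N / 2))"
  proof -
    have "(R\<^sup>2) powr (- (N / 2)) = R powr (- N)"
      using R0 by (simp add: powr_powr flip: powr_numeral)
    moreover have "(1 / c) powr (- (N / 2)) = c powr (N / 2)"
      using c0 by (simp add: powr_divide powr_minus field_simps)
    moreover have "(1 / c * R\<^sup>2) powr (- (N / 2)) = (1 / c) powr (- (N / 2)) * (R\<^sup>2) powr (- (N / 2))"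
      using c0 by (subst powr_mult) auto
    ultimately show ?thesis by (simp only:)
  qed
  also have "\<dots> \<le> (1 / c * Q) powr (- (N / 2))"
    using N0 c0 Q0 QM by (intro powr_mono2' mult_left_mono) (auto simp: R_def)
  also have "\<dots> \<le> \<Lambda>" by (rule first)
  finally show ?thesis
    using first assms(6) unfolding c_def Q_def N_def R_def M_def by simp
qed

end
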